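(* Let $p$ be a prime and let $G$ be a finite group of order $p^n$ such that $|G'|=p$ and $G/G'$ is elementary abelian. Let $H$ be an extra special $p$-subgroup of $G$ such that $G=H\cdot Z(G)$ is the (internal) central product of $H$ and $Z(G)$. Then $G$ is capable if and only if $H$ is capable and $G'$ is a direct summand of $Z(G)$.
   Context: $G'$ denotes the derived subgroup and $Z(G)$ the center of $G$. A group $G$ is called capable if there exists a group $E$ with $G\cong E/Z(E)$. A finite $p$-group $H$ is extra special if $Z(H)=H'$ has order $p$ and $H/H'$ is elementary abelian. That $G=H\cdot Z(G)$ is an internal central product means that $G=HZ(G)$ with $H$ and $Z(G)$ commuting elementwise; here $H\cap Z(G)=Z(H)=H'=G'$. Every group $G$ of order $p^n$ with $|G'|=p$ and $G/G'$ elementary abelian has such a decomposition. $G'$ is a direct summand of $Z(G)$ if there is a subgroup $K\le Z(G)$ (possibly trivial) with $Z(G)=G'\oplus K$. *)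

theory Defs
  imports "HOL-Algebra.Algebra"
begin

definition center :: "('a, 'b) monoid_scheme \<Rightarrow> 'a set" where
  "center G = {z \<in> carrier G. \<forall>g \<in> carrier G. z \<otimes>\<^bsub>G\<^esub> g = g \<otimes>\<^bsub>G\<^esub> z}"

text \<open>
  HOL cannot quantify over groups of all types inside a formula, so the carrier type of the
  witness \<open>E\<close> has to be fixed. Words in the letters \<open>g\<close> and \<open>g\<inverse>\<close>, for \<open>g\<close> of the carrier type
  of \<open>G\<close>, are always enough: if \<open>G \<cong> E/Z(E)\<close>, then the subgroup of \<open>E\<close> generated by one
  representative of each coset of \<open>Z(E)\<close> has the same central quotient. The lemma \<open>capableI\<close>
  below proves this, so no \<open>E\<close> of any type is excluded.
\<close>

definition capable :: "('a, 'b) monoid_scheme \<Rightarrow> bool" where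
  "capable G \<longleftrightarrow> (\<exists>E :: ('a \<times> bool) list monoid. group E \<and> G \<cong> (E Mod (center E)))"

definition elementary_abelian :: "nat \<Rightarrow> ('a, 'b) monoid_scheme \<Rightarrow> bool" where
  "elementary_abelian p A \<longleftrightarrow>
     Factorial_Ring.prime p \<and> comm_group A \<and> (\<forall>x \<in> carrier A. x [^]\<^bsub>A\<^esub> p = \<one>\<^bsub>A\<^esub>)"

definition extra_special :: "nat \<Rightarrow> ('a, 'b) monoid_scheme \<Rightarrow> bool" where
  "extra_special p H \<longleftrightarrow>
     Factorial_Ring.prime p \<and> group H \<and> finite (carrier H) \<and> (\<exists>k. order H = p ^ k) \<and>
     center H = derived H (carrier H) \<and> card (derived H (carrier H)) = p \<and>
     elementary_abelian p (H Mod (derived H (carrier H)))"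

definition internal_central_product ::
    "('a, 'b) monoid_scheme \<Rightarrow> 'a set \<Rightarrow> 'a set \<Rightarrow> bool" where
  "internal_central_product G H K \<longleftrightarrow>
     subgroup H G \<and> subgroup K G \<and>
     (\<forall>h \<in> H. \<forall>k \<in> K. h \<otimes>\<^bsub>G\<^esub> k = k \<otimes>\<^bsub>G\<^esub> h) \<and>
     H <#>\<^bsub>G\<^esub> K = carrier G"

definition direct_summand :: "'a set \<Rightarrow> ('a, 'b) monoid_scheme \<Rightarrow> bool" where
  "direct_summand S A \<longleftrightarrow>
     comm_group A \<and> subgroup S A \<and>
     (\<exists>K. subgroup K A \<and> S \<inter> K = {\<one>\<^bsub>A\<^esub>} \<and> S <#>\<^bsub>A\<^esub> K = carrier A)"

lemma (in group) center_normal: "center G \<lhd> G"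
proof -
  have "subgroup (center G) G"
  proof (rule subgroupI)
    show "center G \<subseteq> carrier G" "center G \<noteq> {}"
      by (auto simp: center_def)
  next
    fix a assume a: "a \<in> center G"
    then have ac: "a \<in> carrier G" by (simp add: center_def)
    have "inv a \<otimes> g = g \<otimes> inv a" if g: "g \<in> carrier G" for g
    proof -
      have "a \<otimes> inv g = inv g \<otimes> a" using a g by (simp add: center_def)
      then have "inv (a \<otimes> inv g) = inv (inv g \<otimes> a)" by simp
      then show ?thesis using ac g by (simp add: inv_mult_group)
    qed
    then show "inv a \<in> center G" using ac by (simp add: center_def)
  next
    fix a b assume a: "a \<in> center G" and b: "b \<in> center G"
    have ab: "a \<in> carrier G" "b \<in> carrier G" using a b by (simp_all add: center_def)
    have "a \<otimes> b \<otimes> g = g \<otimes> (a \<otimes> b)" if g: "g \<in> carrier G" for g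
    proof -
      have "a \<otimes> b \<otimes> g = a \<otimes> (g \<otimes> b)" using b g ab by (simp add: m_assoc center_def)
      also have "\<dots> = (a \<otimes> g) \<otimes> b" using ab g by (simp add: m_assoc)
      also have "\<dots> = (g \<otimes> a) \<otimes> b" using a g by (simp add: center_def)
      finally show ?thesis using ab g by (simp add: m_assoc)
    qed
    then show "a \<otimes> b \<in> center G" using ab by (simp add: center_def)
  qed
  moreover have "x \<otimes> h \<otimes> inv x \<in> center G"
    if x: "x \<in> carrier G" and h: "h \<in> center G" for x h
  proof -
    have hc: "h \<in> carrier G" using h by (simp add: center_def)
    have "x \<otimes> h = h \<otimes> x" using h x by (simp add: center_def)
    then have "x \<otimes> h \<otimes> inv x = h" using x hc by (simp add: m_assoc)
    then show ?thesis using h by simp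
  qed
  ultimately show ?thesis by (simp add: normal_inv_iff)
qed

lemma capableI:
  fixes G :: "('a, 'b) monoid_scheme" and E :: "('c, 'd) monoid_scheme"
  assumes E: "group E" and iso: "G \<cong> (E Mod (center E))"
  shows "capable G"
proof -
  interpret E: group E by (rule E)
  interpret Z: normal "center E" E by (rule E.center_normal)
  obtain f where f: "f \<in> Group.iso G (E Mod (center E))"
    using iso by (auto simp: is_iso_def)
  then have f_img: "f ` carrier G = rcosets\<^bsub>E\<^esub> (center E)"
    by (simp add: Group.iso_def bij_betw_def FactGroup_def)
  define r where "r a = (SOME x. x \<in> f a)" for a
  have r_in: "r a \<in> f a" "f a = center E #>\<^bsub>E\<^esub> r a" "r a \<in> carrier E"
    if a: "a \<in> carrier G" for a
  proof -
    have "f a \<in> rcosets\<^bsub>E\<^esub> (center E)" using f_img a by blast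
    then obtain x where x: "x \<in> carrier E" "f a = center E #>\<^bsub>E\<^esub> x"
      by (auto simp: RCOSETS_def)
    then have "x \<in> f a" using Z.subgroup_axioms E.rcos_self by blast
    then show r: "r a \<in> f a" unfolding r_def by (rule someI)
    then show "f a = center E #>\<^bsub>E\<^esub> r a"
      using E.repr_independence[OF _ x(1) Z.subgroup_axioms] x(2) by simp
    show "r a \<in> carrier E"
      using r E.r_coset_subset_G[OF Z.subset x(1)] x(2) by blast
  qed
  define S where "S = r ` carrier G"
  define E0 where "E0 = generate E S"
  have S: "S \<subseteq> carrier E" using r_in by (auto simp: S_def)
  interpret E0: subgroup E0 E unfolding E0_def by (rule E.generate_is_subgroup[OF S])
  have decomp: "\<exists>z \<in> center E. \<exists>a \<in> carrier G. y = z \<otimes>\<^bsub>E\<^esub> r a"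
    if y: "y \<in> carrier E" for y
  proof -
    have "center E #>\<^bsub>E\<^esub> y \<in> f ` carrier G" using y f_img by (auto simp: RCOSETS_def)
    then obtain a where a: "a \<in> carrier G" "center E #>\<^bsub>E\<^esub> y = center E #>\<^bsub>E\<^esub> r a"
      using r_in by force
    then have "y \<in> center E #>\<^bsub>E\<^esub> r a" using E.rcos_self[OF y Z.subgroup_axioms] by simp
    then show ?thesis using a by (auto simp: r_coset_def)
  qed
  have r_E0: "r a \<in> E0" if "a \<in> carrier G" for a
    using that by (auto simp: E0_def S_def intro: generate.incl)
  have central: "x \<in> center E"
    if x: "x \<in> E0" and c: "\<forall>y \<in> E0. x \<otimes>\<^bsub>E\<^esub> y = y \<otimes>\<^bsub>E\<^esub> x" for x
  proof -
    have xc: "x \<in> carrier E" using x by (rule E0.mem_carrier)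
    have "x \<otimes>\<^bsub>E\<^esub> y = y \<otimes>\<^bsub>E\<^esub> x" if y: "y \<in> carrier E" for y
    proof -
      obtain z a where z: "z \<in> center E" and a: "a \<in> carrier G" and ye: "y = z \<otimes>\<^bsub>E\<^esub> r a"
        using decomp[OF y] by blast
      have zc: "z \<in> carrier E" using z by (rule Z.mem_carrier)
      have "x \<otimes>\<^bsub>E\<^esub> z = z \<otimes>\<^bsub>E\<^esub> x" using z xc by (auto simp only: center_def mem_Collect_eq)
      moreover have "x \<otimes>\<^bsub>E\<^esub> r a = r a \<otimes>\<^bsub>E\<^esub> x" using c r_E0[OF a] by (rule bspec)
      moreover have "x \<otimes>\<^bsub>E\<^esub> (z \<otimes>\<^bsub>E\<^esub> r a) = (x \<otimes>\<^bsub>E\<^esub> z) \<otimes>\<^bsub>E\<^esub> r a"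
        by (intro E.m_assoc[symmetric] xc zc r_in(3)[OF a])+
      moreover have "(z \<otimes>\<^bsub>E\<^esub> r a) \<otimes>\<^bsub>E\<^esub> x = z \<otimes>\<^bsub>E\<^esub> (r a \<otimes>\<^bsub>E\<^esub> x)"
        "(z \<otimes>\<^bsub>E\<^esub> x) \<otimes>\<^bsub>E\<^esub> r a = z \<otimes>\<^bsub>E\<^esub> (x \<otimes>\<^bsub>E\<^esub> r a)"
        by (intro E.m_assoc xc zc r_in(3)[OF a])+
      ultimately show ?thesis unfolding ye by (simp only:)
    qed
    then show ?thesis using xc unfolding center_def by blast
  qed

  define letter where
    "letter = (\<lambda>(a :: 'a, b). if b then r a else inv\<^bsub>E\<^esub> (r a))"
  define wd where "wd l = foldr (\<lambda>x y. letter x \<otimes>\<^bsub>E\<^esub> y) l \<one>\<^bsub>E\<^esub>" for l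
  have words: "\<exists>l \<in> lists (carrier G \<times> UNIV). wd l = x" if "x \<in> E0" for x
  proof -
    have letter_c: "letter x \<in> carrier E" if "x \<in> carrier G \<times> UNIV" for x
      using that r_in(3) by (auto simp: letter_def)
    have wd_c: "wd l \<in> carrier E" if "l \<in> lists (carrier G \<times> UNIV)" for l
      using that by (induction l) (auto simp: wd_def letter_c)
    have wd_app: "wd (l @ m) = wd l \<otimes>\<^bsub>E\<^esub> wd m"
      if "l \<in> lists (carrier G \<times> UNIV)" "m \<in> lists (carrier G \<times> UNIV)" for l m
      using that
    proof (induction l)
      case Nil
      then show ?case using wd_c by (simp add: wd_def)
    next
      case (Cons x l)
      then have "wd ((x # l) @ m) = letter x \<otimes>\<^bsub>E\<^esub> (wd l \<otimes>\<^bsub>E\<^esub> wd m)"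
        by (simp add: wd_def)
      also have "\<dots> = (letter x \<otimes>\<^bsub>E\<^esub> wd l) \<otimes>\<^bsub>E\<^esub> wd m"
        using Cons letter_c wd_c by (simp add: E.m_assoc)
      finally show ?case by (simp add: wd_def)
    qed
    from that show ?thesis unfolding E0_def
    proof (induction rule: generate.induct)
      case one
      show ?case by (rule bexI[of _ "[]"]) (auto simp: wd_def)
    next
      case (incl h)
      then obtain a where "a \<in> carrier G" "h = r a" by (auto simp: S_def)
      then show ?case using r_in(3)
        by (intro bexI[of _ "[(a, True)]"]) (auto simp: wd_def letter_def)
    next
      case (inv h)
      then obtain a where "a \<in> carrier G" "h = r a" by (auto simp: S_def)
      then show ?case using r_in(3)
        by (intro bexI[of _ "[(a, False)]"]) (auto simp: wd_def letter_def)
    next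
      case (eng h1 h2)
      then obtain l m where lm: "l \<in> lists (carrier G \<times> UNIV)" "wd l = h1"
        "m \<in> lists (carrier G \<times> UNIV)" "wd m = h2" by blast
      then have "l @ m \<in> lists (carrier G \<times> UNIV)" by simp
      moreover have "wd (l @ m) = h1 \<otimes>\<^bsub>E\<^esub> h2" using wd_app lm by simp
      ultimately show ?case by blast
    qed
  qed

  define e where "e x = (SOME l. wd l = x)" for x
  have wd_e: "wd (e x) = x" if "x \<in> E0" for x
    unfolding e_def using words[OF that] by (metis (mono_tags) someI_ex)
  define E1 where "E1 = \<lparr>carrier = e ` E0,
    monoid.mult = (\<lambda>x y. e (wd x \<otimes>\<^bsub>E\<^esub> wd y)), one = e \<one>\<^bsub>E\<^esub>\<rparr>"
  have E1: "group E1"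
  proof (rule groupI)
    fix x assume "x \<in> carrier E1"
    then obtain u where u: "u \<in> E0" "x = e u" by (auto simp: E1_def)
    show "\<exists>y \<in> carrier E1. y \<otimes>\<^bsub>E1\<^esub> x = \<one>\<^bsub>E1\<^esub>"
      using u by (intro bexI[of _ "e (inv\<^bsub>E\<^esub> u)"]) (auto simp: E1_def wd_e)
  qed (auto simp: E1_def wd_e E.m_assoc)
  define q where "q x = center E #>\<^bsub>E\<^esub> wd x" for x
  have hom: "group_hom E1 (E Mod (center E)) q"
  proof -
    have "q \<in> hom E1 (E Mod (center E))"
      by (rule homI) (auto simp: E1_def q_def wd_e FactGroup_def RCOSETS_def Z.rcos_sum)
    then show ?thesis
      using E1 Z.factorgroup_is_group by (simp add: group_hom_def group_hom_axioms_def)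
  qed
  have surj: "q ` carrier E1 = carrier (E Mod (center E))"
  proof
    show "q ` carrier E1 \<subseteq> carrier (E Mod (center E))"
      using E0.mem_carrier by (force simp: E1_def q_def wd_e FactGroup_def RCOSETS_def)
    show "carrier (E Mod (center E)) \<subseteq> q ` carrier E1"
    proof
      fix C assume "C \<in> carrier (E Mod (center E))"
      then obtain a where a: "a \<in> carrier G" "C = f a"
        using f_img by (auto simp: FactGroup_def)
      then have "C = q (e (r a))" using r_in r_E0 by (simp add: q_def wd_e)
      then show "C \<in> q ` carrier E1" using r_E0[OF a(1)] by (auto simp: E1_def)
    qed
  qed
  have ker: "kernel E1 (E Mod (center E)) q = center E1"
  proof -
    have eq_e: "e u = e v \<longleftrightarrow> u = v" if "u \<in> E0" "v \<in> E0" for u v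
      using that wd_e by metis
    have q1: "q (e u) = center E \<longleftrightarrow> u \<in> center E" if u: "u \<in> E0" for u
    proof -
      have "u \<in> center E #>\<^bsub>E\<^esub> u" by (rule E.rcos_self[OF E0.mem_carrier[OF u] Z.subgroup_axioms])
      moreover have "center E #>\<^bsub>E\<^esub> u = center E" if "u \<in> center E"
        by (rule Z.rcos_const[OF E that])
      ultimately show ?thesis unfolding q_def wd_e[OF u] by blast
    qed
    have q2: "e u \<in> center E1 \<longleftrightarrow> u \<in> center E" if u: "u \<in> E0" for u
    proof -
      have "e u \<in> center E1 \<longleftrightarrow> (\<forall>v \<in> E0. e (u \<otimes>\<^bsub>E\<^esub> v) = e (v \<otimes>\<^bsub>E\<^esub> u))"
        using u by (simp add: center_def E1_def wd_e)
      also have "\<dots> \<longleftrightarrow> (\<forall>v \<in> E0. u \<otimes>\<^bsub>E\<^esub> v = v \<otimes>\<^bsub>E\<^esub> u)"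
        by (intro ball_cong refl eq_e E0.m_closed u)
      also have "\<dots> \<longleftrightarrow> u \<in> center E"
        using central[OF u] E0.mem_carrier unfolding center_def by blast
      finally show ?thesis .
    qed
    have "center E1 \<subseteq> e ` E0" by (auto simp: center_def E1_def)
    then show ?thesis
      using q1 q2 by (auto simp: kernel_def E1_def FactGroup_def)
  qed
  have "(E1 Mod (center E1)) \<cong> (E Mod (center E))"
    using group_hom.FactGroup_iso[OF hom surj] by (simp add: ker)
  then have "(E Mod (center E)) \<cong> (E1 Mod (center E1))"
    using group.iso_sym[OF normal.factorgroup_is_group[OF group.center_normal[OF E1]]] by blast
  then have "G \<cong> (E1 Mod (center E1))"
    using iso by (rule iso_trans[rotated])
  then show ?thesis using E1 by (auto simp: capable_def)
qed

end

theory Submission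
  imports Defs
begin

text \<open>
  A group \<open>G\<close> is capable iff there is an epimorphism \<open>\<pi> : E \<rightarrow> G\<close> whose kernel is exactly \<open>Z(E)\<close>
  (locale \<open>central_epimorphism\<close>), and everything is read off from commutators in such an \<open>E\<close>.

  Suppose \<open>G\<close> is capable. If \<open>z \<in> E\<close> lies over \<open>Z(G)\<close>, then \<open>g \<mapsto> [z, g]\<close> is a homomorphism from \<open>E\<close>
  to the abelian group \<open>Z(E)\<close>. It kills \<open>E'\<close> and \<open>Z(E)\<close>, so \<open>z\<close> commutes with every element lying
  over \<open>G'\<close> (\<open>lifts_of_center_and_derived_commute\<close>). Two consequences follow.
  \<^item> As \<open>g\<^sup>p\<close> lies over \<open>G'\<close>, we get \<open>[z\<^sup>p, g] = [z, g]\<^sup>p = [z, g\<^sup>p] = 1\<close> for all \<open>g\<close>. So \<open>z\<^sup>p\<close>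
    is central in \<open>E\<close>, which means that \<open>Z(G)\<close> has exponent \<open>p\<close> (\<open>center_exponent\<close>). In an elementary
    abelian group every subgroup has a complement (\<open>subgroup_complement\<close>), in particular \<open>G'\<close> in
    \<open>Z(G)\<close>.
  \<^item> Let \<open>F\<close> be the preimage of \<open>H\<close>. An element of \<open>Z(F)\<close> lies over \<open>Z(H) = G'\<close>, hence commutes with
    the lifts of \<open>Z(G)\<close> as well as with \<open>F\<close>, and these generate \<open>E\<close> because \<open>G = H Z(G)\<close>. So
    \<open>Z(F) = Z(E)\<close>, and \<open>F\<close> shows that \<open>H\<close> is capable (\<open>capable_central_factor\<close>).

  Conversely, let \<open>H \<cong> F/Z(F)\<close> and \<open>Z(G) = G' \<oplus> K\<close>. Then \<open>G \<cong> H \<times> K\<close> with \<open>K\<close> elementary abelian. The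
  factor \<open>K\<close> need not be capable by itself (it may be cyclic of order \<open>p\<close>), so a direct product of
  two covers does not suffice. Instead, \<open>F \<times> K\<close> is extended by a further copy of \<open>K\<close> along a pairing
  \<open>\<beta> : H \<times> K \<rightarrow> K\<close>, which makes each nontrivial element of \<open>K\<close> fail to commute with something in \<open>F\<close>
  (\<open>capable_DirProd\<close>). Such a pairing is \<open>\<beta>(h, k) = k\<^bsup>\<phi>(h)\<^esup>\<close> for a nonzero homomorphism
  \<open>\<phi> : H \<rightarrow> \<int>/p\<close>; for \<open>\<phi>\<close> one can take the commutator with a noncentral element of \<open>H\<close>
  (\<open>capable_DirProd_extra_special\<close>).
\<close>

section \<open>Capability and central epimorphisms\<close>

locale central_epimorphism = group_hom E G \<pi>
  for E (structure) and G (structure) and \<pi> +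
  assumes surj: "\<pi> ` carrier E = carrier G"
    and kernel_eq_center: "kernel E G \<pi> = center E"

lemma (in central_epimorphism) capable_image: "capable G"
proof -
  have "(E Mod center E) \<cong> G"
    using FactGroup_iso[OF surj] by (simp add: kernel_eq_center)
  then have "G \<cong> (E Mod center E)"
    using group.iso_sym[OF normal.factorgroup_is_group[OF G.center_normal]] by blast
  then show ?thesis
    by (rule capableI[OF G.group_axioms])
qed

text \<open>
  Together with \<open>capable_image\<close> this replaces the quotient by a map: arguments can then be carried
  out with elements of \<open>E\<close> instead of cosets.
\<close>

lemma (in group) capable_imp_central_epimorphism:
  assumes "capable G"
  obtains E :: "('a \<times> bool) list monoid" and \<pi> where "central_epimorphism E G \<pi>"
proof -
  obtain E :: "('a \<times> bool) list monoid" where E: "group E" and iso: "G \<cong> (E Mod center E)"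
    using assms by (auto simp: capable_def)
  interpret E: group E by (rule E)
  interpret Z: normal "center E" E by (rule E.center_normal)
  have Mod: "group (E Mod center E)" by (rule Z.factorgroup_is_group)
  obtain f where f: "f \<in> Group.iso (E Mod center E) G"
    using iso_sym[OF iso] by (auto simp: is_iso_def)
  interpret f: group_hom "E Mod center E" G f
    using Mod f by (simp add: group_hom_def group_hom_axioms_def Group.iso_def)
  define \<pi> where "\<pi> x = f (center E #>\<^bsub>E\<^esub> x)" for x
  have coset: "center E #>\<^bsub>E\<^esub> x \<in> carrier (E Mod center E)" if "x \<in> carrier E" for x
    using that by (auto simp: FactGroup_def RCOSETS_def)
  have hom: "\<pi> \<in> hom E G"
    using Group.hom_compose[OF Z.r_coset_hom_Mod f.homh] by (simp add: \<pi>_def[abs_def] comp_def)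
  have inj: "inj_on f (carrier (E Mod center E))" and surj0: "f ` carrier (E Mod center E) = carrier G"
    using f by (simp_all add: Group.iso_def bij_betw_def)
  have "carrier (E Mod center E) = (\<lambda>x. center E #>\<^bsub>E\<^esub> x) ` carrier E"
    by (auto simp: FactGroup_def RCOSETS_def)
  with surj0 have surj: "\<pi> ` carrier E = carrier G"
    by (simp add: \<pi>_def image_image)
  have "\<pi> x = \<one> \<longleftrightarrow> x \<in> center E" if x: "x \<in> carrier E" for x
  proof -
    have "\<pi> x = \<one> \<longleftrightarrow> center E #>\<^bsub>E\<^esub> x = \<one>\<^bsub>E Mod center E\<^esub>"
      using f.inj_on_one_iff inj coset[OF x] f.hom_one by (auto simp: \<pi>_def)
    also have "\<dots> \<longleftrightarrow> x \<in> center E"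
      using E.rcos_self[OF x Z.subgroup_axioms] Z.rcos_const[OF E]
      by (auto simp: FactGroup_def)
    finally show ?thesis .
  qed
  then have "kernel E G \<pi> = center E"
    unfolding kernel_def using E.center_normal[THEN normal_imp_subgroup, THEN subgroup.subset] by blast
  with hom surj have "central_epimorphism E G \<pi>"
    by unfold_locales auto
  then show thesis by (rule that)
qed

lemma capable_iso:
  fixes G :: "('a, 'c) monoid_scheme" and G' :: "('b, 'd) monoid_scheme"
  assumes iso: "G \<cong> G'" and "capable G'"
  shows "capable G"
proof -
  obtain E :: "('b \<times> bool) list monoid" where E: "group E" and iso': "G' \<cong> (E Mod center E)"
    using assms(2) by (auto simp: capable_def)
  show ?thesis
    using E iso_trans[OF iso iso'] by (rule capableI)
qed

section \<open>Commutators with an element that is central modulo the center\<close>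

lemma (in group) center_memD:
  assumes "z \<in> center G"
  shows "z \<in> carrier G" and "g \<in> carrier G \<Longrightarrow> z \<otimes> g = g \<otimes> z"
  using assms unfolding center_def by blast+

lemma (in group) center_memI:
  assumes "z \<in> carrier G" and "\<And>g. g \<in> carrier G \<Longrightarrow> z \<otimes> g = g \<otimes> z"
  shows "z \<in> center G"
  using assms unfolding center_def by blast

lemma (in group) comm_group_center: "comm_group (G\<lparr>carrier := center G\<rparr>)"
proof -
  have "subgroup (center G) G"
    using center_normal by (rule normal_imp_subgroup)
  then have "group (G\<lparr>carrier := center G\<rparr>)"
    by (rule subgroup_imp_group)
  then show ?thesis
    by (rule group.group_comm_groupI) (simp add: center_memD)
qed

lemma (in group) m_inv_cancel:
  assumes "x \<in> carrier G" "y \<in> carrier G"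
  shows "inv x \<otimes> (x \<otimes> y) = y" and "x \<otimes> (inv x \<otimes> y) = y"
  using assms by (simp_all flip: m_assoc)

text \<open>
  Since \<open>[x, h]\<close> is central, it can be moved past \<open>g\<^sup>-\<^sup>1\<close> in
  \<open>[x, g h] = (x g x\<^sup>-\<^sup>1) [x, h] g\<^sup>-\<^sup>1\<close>.
\<close>

lemma (in group) commutator_hom:
  assumes x: "x \<in> carrier G"
    and central: "\<And>g. g \<in> carrier G \<Longrightarrow> x \<otimes> g \<otimes> inv x \<otimes> inv g \<in> center G"
  shows "group_hom G (G\<lparr>carrier := center G\<rparr>) (\<lambda>g. x \<otimes> g \<otimes> inv x \<otimes> inv g)"
proof -
  have "x \<otimes> (g \<otimes> h) \<otimes> inv x \<otimes> inv (g \<otimes> h)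
      = (x \<otimes> g \<otimes> inv x \<otimes> inv g) \<otimes> (x \<otimes> h \<otimes> inv x \<otimes> inv h)"
    if g: "g \<in> carrier G" and h: "h \<in> carrier G" for g h
  proof -
    let ?c = "x \<otimes> h \<otimes> inv x \<otimes> inv h"
    have c: "?c \<in> carrier G" using x h by simp
    have "x \<otimes> (g \<otimes> h) \<otimes> inv x \<otimes> inv (g \<otimes> h)
        = (x \<otimes> g \<otimes> inv x) \<otimes> (?c \<otimes> inv g)"
      using x g h by (simp add: m_assoc inv_mult_group m_inv_cancel)
    also have "?c \<otimes> inv g = inv g \<otimes> ?c"
      by (rule center_memD(2)[OF central[OF h]]) (simp add: g)
    finally show ?thesis
      using x g h by (simp add: m_assoc)
  qed
  then have "(\<lambda>g. x \<otimes> g \<otimes> inv x \<otimes> inv g) \<in> hom G (G\<lparr>carrier := center G\<rparr>)"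
    using central by (auto intro!: homI)
  then show ?thesis
    using comm_group_center by (simp add: group_hom_def group_hom_axioms_def comm_group_def)
qed

lemma (in group_hom) derived_subset_kernel:
  assumes "comm_group H"
  shows "derived G (carrier G) \<subseteq> kernel G H h"
proof -
  have "h ` derived G (carrier G) = derived H (h ` carrier G)"
    by (simp add: derived_img)
  also have "\<dots> = {\<one>\<^bsub>H\<^esub>}"
    by (rule comm_group.derived_eq_singleton[OF assms]) auto
  finally show ?thesis
    using G.derived_in_carrier[of "carrier G"] by (auto simp: kernel_def)
qed

lemma (in group) commutator_eq_one_iff:
  assumes "x \<in> carrier G" "g \<in> carrier G"
  shows "x \<otimes> g \<otimes> inv x \<otimes> inv g = \<one> \<longleftrightarrow> x \<otimes> g = g \<otimes> x"
proof -
  have "x \<otimes> g \<otimes> inv x \<otimes> inv g = (x \<otimes> g) \<otimes> inv (g \<otimes> x)"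
    using assms by (simp add: inv_mult_group m_assoc)
  then show ?thesis
    using assms inv_solve_right'[of "\<one>" "x \<otimes> g" "g \<otimes> x"] by auto
qed

section \<open>Consequences of capability\<close>

context central_epimorphism
begin

lemma pi_eq_one_iff: "x \<in> carrier E \<Longrightarrow> \<pi> x = \<one>\<^bsub>G\<^esub> \<longleftrightarrow> x \<in> center E"
  using kernel_eq_center by (auto simp: kernel_def)

lemma lift:
  assumes "g \<in> carrier G"
  obtains x where "x \<in> carrier E" "\<pi> x = g"
proof -
  have "g \<in> \<pi> ` carrier E" using assms surj by simp
  then show thesis using that by auto
qed

lemma commutator_with_lift_of_center:
  assumes z: "z \<in> carrier E" "\<pi> z \<in> center G" and g: "g \<in> carrier E"
  shows "z \<otimes> g \<otimes> inv z \<otimes> inv g \<in> center E"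
proof -
  have "\<pi> z \<otimes>\<^bsub>G\<^esub> \<pi> g = \<pi> g \<otimes>\<^bsub>G\<^esub> \<pi> z"
    by (rule H.center_memD(2)) (use z g in simp_all)
  then have "\<pi> (z \<otimes> g \<otimes> inv z \<otimes> inv g) = \<one>\<^bsub>G\<^esub>"
    using H.commutator_eq_one_iff[of "\<pi> z" "\<pi> g"] z g by simp
  then show ?thesis
    by (intro pi_eq_one_iff[THEN iffD1]) (use z(1) g in simp_all)
qed

text \<open>
  The homomorphism \<open>[z, \<cdot>]\<close> into \<open>Z(E)\<close> vanishes on \<open>E'\<close>. Since \<open>\<pi>\<close> maps \<open>E'\<close> onto \<open>G'\<close>, every
  lift \<open>d\<close> of an element of \<open>G'\<close> differs from some \<open>d' \<in> E'\<close> by a factor \<open>w \<in> Z(E)\<close>.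
\<close>

lemma lifts_of_center_and_derived_commute:
  assumes z: "z \<in> carrier E" "\<pi> z \<in> center G"
    and d: "d \<in> carrier E" "\<pi> d \<in> derived G (carrier G)"
  shows "z \<otimes> d = d \<otimes> z"
proof -
  have "\<pi> ` derived E (carrier E) = derived G (carrier G)"
    using derived_img[of "carrier E"] surj by simp
  with d(2) obtain d' where d': "d' \<in> derived E (carrier E)" "\<pi> d' = \<pi> d"
    by (metis imageE)
  have d'_c: "d' \<in> carrier E"
    using d'(1) G.derived_in_carrier[of "carrier E"] by auto
  interpret c: group_hom E "E\<lparr>carrier := center E\<rparr>" "\<lambda>g. z \<otimes> g \<otimes> inv z \<otimes> inv g"
    by (rule G.commutator_hom[OF z(1) commutator_with_lift_of_center[OF z]])
  have "z \<otimes> d' = d' \<otimes> z"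
    using c.derived_subset_kernel[OF G.comm_group_center] d'(1) d'_c z(1)
    by (auto simp: kernel_def G.commutator_eq_one_iff)
  moreover define w where "w = d \<otimes> inv d'"
  have w_c: "w \<in> carrier E" and d_eq: "d = w \<otimes> d'"
    using d(1) d'_c by (simp_all add: w_def G.m_assoc)
  have "\<pi> w = \<one>\<^bsub>G\<^esub>"
    using d(1) d'(2) d'_c by (simp add: w_def)
  then have "w \<in> center E"
    using w_c pi_eq_one_iff by blast
  then have "w \<otimes> z = z \<otimes> w"
    using z(1) by (rule G.center_memD(2))
  ultimately have "z \<otimes> w \<otimes> d' = w \<otimes> (d' \<otimes> z)"
    using w_c d'_c z(1) by (metis G.m_assoc)
  then show ?thesis
    unfolding d_eq using w_c d'_c z(1) by (simp add: G.m_assoc)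
qed

text \<open>
  If \<open>x\<close> lies over \<open>z\<close>, then \<open>c = [x, g]\<close> is central, and \<open>c\<^sup>n\<close> equals both \<open>[x, g\<^sup>n]\<close> and
  \<open>[x\<^sup>n, g]\<close>. The first is trivial because \<open>g\<^sup>n\<close> lies over \<open>G'\<close>; hence so is the second.
\<close>

lemma center_exponent:
  assumes pow: "\<And>g. g \<in> carrier G \<Longrightarrow> g [^]\<^bsub>G\<^esub> (n::nat) \<in> derived G (carrier G)"
    and z: "z \<in> center G"
  shows "z [^]\<^bsub>G\<^esub> n = \<one>\<^bsub>G\<^esub>"
proof -
  have "z \<in> carrier G" using z by (rule H.center_memD(1))
  then obtain x where x: "x \<in> carrier E" "\<pi> x = z" by (rule lift)
  have "x [^] n \<otimes> g = g \<otimes> x [^] n" if g: "g \<in> carrier E" for g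
  proof -
    define c where "c = x \<otimes> g \<otimes> inv x \<otimes> inv g"
    have c: "c \<in> center E"
      unfolding c_def by (rule commutator_with_lift_of_center) (use x z g in auto)
    have cc: "c \<in> carrier E" using c by (rule G.center_memD(1))
    interpret c: group_hom E "E\<lparr>carrier := center E\<rparr>" "\<lambda>h. x \<otimes> h \<otimes> inv x \<otimes> inv h"
      by (rule G.commutator_hom) (use x z commutator_with_lift_of_center in auto)
    have gn: "g [^] n \<in> carrier E" "\<pi> (g [^] n) \<in> derived G (carrier G)"
      using g pow by (auto simp: hom_nat_pow)
    have "c [^] n = x \<otimes> g [^] n \<otimes> inv x \<otimes> inv (g [^] n)"
      using c.hom_nat_pow[OF g, of n] by (simp add: c_def flip: G.nat_pow_consistent)
    also have "\<dots> = \<one>"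
      using lifts_of_center_and_derived_commute[of x, OF _ _ gn] x z gn(1)
      by (intro G.commutator_eq_one_iff[THEN iffD2]) simp_all
    finally have cn: "c [^] n = \<one>" .
    have xg: "x \<otimes> g = c \<otimes> g \<otimes> x"
      using x(1) g by (simp add: c_def G.m_assoc G.m_inv_cancel)
    have "x [^] m \<otimes> g = c [^] m \<otimes> g \<otimes> x [^] m" for m :: nat
    proof (induction m)
      case (Suc m)
      have c_Suc: "c [^] Suc m = c \<otimes> c [^] m"
        using cc by (rule G.nat_pow_Suc2)
      have "x [^] Suc m \<otimes> g = x [^] m \<otimes> (x \<otimes> g)"
        using x(1) g by (simp add: G.m_assoc)
      also have "\<dots> = (x [^] m \<otimes> c) \<otimes> g \<otimes> x"
        using x(1) g cc by (simp add: xg G.m_assoc)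
      also have "x [^] m \<otimes> c = c \<otimes> x [^] m"
        using G.center_memD(2)[OF c] x(1) by simp
      also have "c \<otimes> x [^] m \<otimes> g \<otimes> x = c \<otimes> (x [^] m \<otimes> g) \<otimes> x"
        using x(1) g cc by (simp add: G.m_assoc)
      also have "\<dots> = c [^] Suc m \<otimes> g \<otimes> x [^] Suc m"
        using x(1) g cc by (simp only: Suc.IH c_Suc) (simp add: G.m_assoc)
      finally show ?case .
    qed (use g in simp)
    then show ?thesis
      using cn x(1) g by simp
  qed
  then have "x [^] n \<in> center E"
    using x(1) by (simp add: center_def)
  then show ?thesis
    using x by (simp add: hom_nat_pow flip: pi_eq_one_iff)
qed

text \<open>
  The restriction of \<open>\<pi>\<close> to the preimage \<open>F\<close> of \<open>H\<close> is again a central epimorphism. The only question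
  is whether \<open>F\<close> has a larger center than \<open>E\<close>: a central element of \<open>F\<close> lies over \<open>Z(H) \<subseteq> G'\<close>, so it
  also commutes with the lifts of \<open>Z(G)\<close>.
\<close>

lemma capable_central_factor:
  assumes H: "subgroup H G"
    and factor: "H <#>\<^bsub>G\<^esub> center G = carrier G"
    and center_H: "center (G\<lparr>carrier := H\<rparr>) \<subseteq> derived G (carrier G)"
  shows "capable (G\<lparr>carrier := H\<rparr>)"
proof -
  define F where "F = {x \<in> carrier E. \<pi> x \<in> H}"
  interpret S: subgroup H G by (rule H)
  have F: "subgroup F E"
  proof (rule G.subgroupI)
    have "\<one> \<in> F" by (simp add: F_def)
    then show "F \<noteq> {}" by blast
    show "F \<subseteq> carrier E" unfolding F_def by blast
    show "inv x \<in> F" if "x \<in> F" for x using that by (simp add: F_def)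
    show "x \<otimes> y \<in> F" if "x \<in> F" "y \<in> F" for x y using that by (simp add: F_def)
  qed
  interpret F: group "E\<lparr>carrier := F\<rparr>"
    using F by (rule G.subgroup_imp_group)
  have "\<pi> ` F = H"
  proof
    show "\<pi> ` F \<subseteq> H" by (auto simp: F_def)
    show "H \<subseteq> \<pi> ` F"
    proof
      fix h assume h: "h \<in> H"
      then obtain x where "x \<in> carrier E" "\<pi> x = h" using lift S.mem_carrier by metis
      then show "h \<in> \<pi> ` F" using h by (auto simp: F_def)
    qed
  qed
  moreover have "kernel (E\<lparr>carrier := F\<rparr>) (G\<lparr>carrier := H\<rparr>) \<pi> = center (E\<lparr>carrier := F\<rparr>)"
  proof
    show "kernel (E\<lparr>carrier := F\<rparr>) (G\<lparr>carrier := H\<rparr>) \<pi> \<subseteq> center (E\<lparr>carrier := F\<rparr>)"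
    proof
      fix x assume "x \<in> kernel (E\<lparr>carrier := F\<rparr>) (G\<lparr>carrier := H\<rparr>) \<pi>"
      then have x: "x \<in> F" "x \<in> center E"
        by (auto simp: kernel_def F_def pi_eq_one_iff)
      then show "x \<in> center (E\<lparr>carrier := F\<rparr>)"
        using G.center_memD(2)[OF x(2)] by (intro F.center_memI) (simp_all add: F_def)
    qed
    show "center (E\<lparr>carrier := F\<rparr>) \<subseteq> kernel (E\<lparr>carrier := F\<rparr>) (G\<lparr>carrier := H\<rparr>) \<pi>"
    proof
      fix x assume x: "x \<in> center (E\<lparr>carrier := F\<rparr>)"
      then have xF: "x \<in> F"
        using F.center_memD(1) by simp
      then have xc: "x \<in> carrier E" and xH: "\<pi> x \<in> H"
        by (simp_all add: F_def)
      have comm_F: "x \<otimes> y = y \<otimes> x" if "y \<in> F" for y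
        using F.center_memD(2)[OF x] that by simp
      have "\<pi> x \<otimes>\<^bsub>G\<^esub> h = h \<otimes>\<^bsub>G\<^esub> \<pi> x" if h: "h \<in> H" for h
      proof -
        obtain y where "y \<in> carrier E" "\<pi> y = h"
          using lift S.subset h by blast
        then show ?thesis
          using comm_F[of y] h xc by (auto simp: F_def simp flip: hom_mult)
      qed
      then have "\<pi> x \<in> center (G\<lparr>carrier := H\<rparr>)"
        using xH by (intro group.center_memI[OF H.subgroup_imp_group[OF H]]) simp_all
      then have xd: "\<pi> x \<in> derived G (carrier G)"
        using center_H by blast
      have "x \<otimes> e = e \<otimes> x" if e: "e \<in> carrier E" for e
      proof -
        have "\<pi> e \<in> H <#>\<^bsub>G\<^esub> center G"
          using e factor by simp
        then obtain h z where h: "h \<in> H" and z: "z \<in> center G" and hz: "\<pi> e = h \<otimes>\<^bsub>G\<^esub> z"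
          unfolding set_mult_def by blast
        obtain y where y: "y \<in> carrier E" "\<pi> y = h"
          using lift S.subset h by blast
        (* e = y w with y in F, and w a lift of the central element z *)
        define w where "w = inv y \<otimes> e"
        have w: "w \<in> carrier E" "e = y \<otimes> w"
          using y e by (simp_all add: w_def G.m_inv_cancel)
        have "\<pi> w = z"
          using y e h z by (simp add: w_def hz H.m_inv_cancel H.center_memD(1))
        then have wx: "w \<otimes> x = x \<otimes> w"
          using lifts_of_center_and_derived_commute[OF w(1) _ xc xd] z by simp
        have xy: "x \<otimes> y = y \<otimes> x"
          using comm_F[of y] y h by (simp add: F_def)
        have "x \<otimes> e = (y \<otimes> x) \<otimes> w"
          using xc y(1) w by (simp add: G.m_assoc flip: xy)
        also have "\<dots> = y \<otimes> (w \<otimes> x)"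
          using xc y(1) w(1) by (simp add: G.m_assoc wx)
        finally show ?thesis
          using xc y(1) w by (simp add: G.m_assoc)
      qed
      then have "x \<in> center E"
        using xc unfolding center_def by blast
      then show "x \<in> kernel (E\<lparr>carrier := F\<rparr>) (G\<lparr>carrier := H\<rparr>) \<pi>"
        using xF xc pi_eq_one_iff by (simp add: kernel_def)
    qed
  qed
  moreover have "group (G\<lparr>carrier := H\<rparr>)"
    using H by (rule H.subgroup_imp_group)
  moreover have "\<pi> \<in> hom (E\<lparr>carrier := F\<rparr>) (G\<lparr>carrier := H\<rparr>)"
    by (rule homI) (auto simp: F_def)
  ultimately have "central_epimorphism (E\<lparr>carrier := F\<rparr>) (G\<lparr>carrier := H\<rparr>) \<pi>"
    by (intro central_epimorphism.intro group_hom.intro group_hom_axioms.intro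
        central_epimorphism_axioms.intro F.group_axioms) simp_all
  then show ?thesis
    by (rule central_epimorphism.capable_image)
qed

end

section \<open>Complements in elementary abelian groups\<close>

text \<open>
  A subgroup \<open>K\<close> that is maximal with \<open>S \<inter> K = 1\<close> is a complement. Otherwise adjoin some \<open>x \<notin> S K\<close> to
  \<open>K\<close>: by maximality \<open>k x\<^bsup>i\<^esup> \<in> S\<close> is nontrivial for some \<open>k \<in> K\<close> and \<open>i\<close>, so \<open>x\<^bsup>i\<^esup> \<in> S K\<close> with \<open>p\<close> not
  dividing \<open>i\<close>, and \<open>x\<close> is a power of \<open>x\<^bsup>i\<^esup>\<close>.
\<close>

lemma (in comm_group) subgroup_complement:
  assumes fin: "finite (carrier G)"
    and p: "Factorial_Ring.prime (p::nat)"
    and exp: "\<And>x. x \<in> carrier G \<Longrightarrow> x [^] p = \<one>"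
    and S: "subgroup S G"
  obtains K where "subgroup K G" "S \<inter> K = {\<one>}" "S <#> K = carrier G"
proof -
  interpret S: subgroup S G by (rule S)
  define A where "A = {K. subgroup K G \<and> S \<inter> K = {\<one>}}"
  have "A \<subseteq> Pow (carrier G)"
    by (auto simp: A_def dest: subgroup.subset)
  then have "finite A"
    using fin by (simp add: finite_subset)
  moreover have "{\<one>} \<in> A"
    using triv_subgroup S.one_closed by (auto simp: A_def)
  ultimately obtain K where KA: "K \<in> A" and max: "\<And>K'. K' \<in> A \<Longrightarrow> K \<subseteq> K' \<Longrightarrow> K = K'"
    using finite_has_maximal[of A] by blast
  have K: "subgroup K G" and SK: "S \<inter> K = {\<one>}"
    using KA by (simp_all add: A_def)
  interpret K: subgroup K G by (rule K)
  interpret T: subgroup "S <#> K" G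
    using S K by (rule mult_subgroups)
  have "x \<in> S <#> K" if x: "x \<in> carrier G" for x
  proof (rule ccontr)
    assume nx: "x \<notin> S <#> K"
    define K' where "K' = K <#> generate G {x}"
    have gen: "subgroup (generate G {x}) G"
      by (rule generate_is_subgroup) (simp add: x)
    have K': "subgroup K' G"
      unfolding K'_def using K gen by (rule mult_subgroups)
    have mem_K': "k \<otimes> y \<in> K'" if "k \<in> K" "y \<in> generate G {x}" for k y
      using that unfolding K'_def set_mult_def by blast
    have "k \<in> K'" if "k \<in> K" for k
      using mem_K'[OF that subgroup.one_closed[OF gen]] that by simp
    then have "K \<subseteq> K'" by blast
    moreover have "x \<in> K'"
      using mem_K'[OF K.one_closed generate.incl[of x "{x}"]] x by simp
    moreover have "x \<notin> K"
    proof
      assume "x \<in> K"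
      with S.one_closed have "\<one> \<otimes> x \<in> S <#> K" unfolding set_mult_def by blast
      then show False using nx x by simp
    qed
    ultimately have "K' \<notin> A" using max by blast
    then obtain y where y: "y \<in> S" "y \<in> K'" "y \<noteq> \<one>"
      using K' S.one_closed subgroup.one_closed[OF K'] unfolding A_def by blast
    then obtain k i where k: "k \<in> K" and yk: "y = k \<otimes> x [^] (i::int)"
      unfolding K'_def set_mult_def generate_pow[OF x] by blast
    have kc: "k \<in> carrier G" using k by simp
    have "x [^] i = y \<otimes> inv k"
      using kc x by (simp add: yk m_ac m_inv_cancel)
    moreover have "inv k \<in> K" using k by simp
    ultimately have xi: "x [^] i \<in> S <#> K"
      using y(1) unfolding set_mult_def by blast
    show False
    proof (cases "int p dvd i")
      case True
      then obtain j where "i = int p * j" by (elim dvdE)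
      then have "x [^] i = \<one>"
        using exp[OF x] x by (simp add: int_pow_int flip: int_pow_pow)
      then have "y \<in> K" using yk k kc by simp
      then show False using SK y by blast
    next
      case False
      then have "coprime (int p) i"
        using p by (simp add: prime_imp_coprime)
      then obtain u v where uv: "u * int p + v * i = 1"
        using bezout_int[of "int p" i] by auto
      have "x = x [^] (u * int p + v * i)"
        using x by (simp add: uv)
      also have "\<dots> = (x [^] int p) [^] u \<otimes> (x [^] i) [^] v"
        using x by (simp add: int_pow_mult int_pow_pow mult.commute)
      also have "\<dots> = (x [^] i) [^] v"
        using x exp[OF x] by (simp add: int_pow_int)
      also have "\<dots> \<in> S <#> K"
        using xi T.subgroup_axioms by (metis subgroup_int_pow_closed)
      finally show False using nx by simp
    qed
  qed
  then have "S <#> K = carrier G"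
    using T.subset by blast
  with K SK show thesis by (rule that)
qed

section \<open>Capability of a direct product with a group of prime exponent\<close>

text \<open>
  The values \<open>\<chi>(h) = c\<^bsup>m\<^esup>\<close> are powers of \<open>c = \<chi>(y)\<close>, a generator of the group \<open>D\<close> of order \<open>p\<close>. The
  exponent \<open>m\<close> is determined modulo \<open>p\<close>, so \<open>\<beta>(h, k) = k\<^bsup>m\<^esup>\<close> depends only on \<open>h\<close> and \<open>k\<close> when \<open>K\<close> has
  exponent \<open>p\<close>. It is nondegenerate in \<open>k\<close> because \<open>\<beta>(y, k) = k\<close>.
\<close>

lemma prime_order_pairing:
  fixes K :: "('c, 'd) monoid_scheme"
  assumes p: "Factorial_Ring.prime p"
    and "group_hom H D \<chi>"
    and D: "order D = p"
    and y: "y \<in> carrier H" "\<chi> y \<noteq> \<one>\<^bsub>D\<^esub>"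
    and "comm_group K"
    and exp: "\<And>k. k \<in> carrier K \<Longrightarrow> k [^]\<^bsub>K\<^esub> p = \<one>\<^bsub>K\<^esub>"
  obtains \<beta> where
    "\<And>h k. h \<in> carrier H \<Longrightarrow> k \<in> carrier K \<Longrightarrow> \<beta> h k \<in> carrier K"
    "\<And>h h' k. h \<in> carrier H \<Longrightarrow> h' \<in> carrier H \<Longrightarrow> k \<in> carrier K \<Longrightarrow>
      \<beta> (h \<otimes>\<^bsub>H\<^esub> h') k = \<beta> h k \<otimes>\<^bsub>K\<^esub> \<beta> h' k"
    "\<And>h k k'. h \<in> carrier H \<Longrightarrow> k \<in> carrier K \<Longrightarrow> k' \<in> carrier K \<Longrightarrow>
      \<beta> h (k \<otimes>\<^bsub>K\<^esub> k') = \<beta> h k \<otimes>\<^bsub>K\<^esub> \<beta> h k'"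
    "\<And>k. k \<in> carrier K \<Longrightarrow> \<forall>h \<in> carrier H. \<beta> h k = \<one>\<^bsub>K\<^esub> \<Longrightarrow> k = \<one>\<^bsub>K\<^esub>"
proof -
  interpret \<chi>: group_hom H D \<chi> by fact
  interpret K: comm_group K by fact
  define c where "c = \<chi> y"
  have c: "c \<in> carrier D" "c \<noteq> \<one>\<^bsub>D\<^esub>"
    using y by (simp_all add: c_def)
  have "\<chi>.H.ord c dvd p"
    using \<chi>.H.ord_dvd_group_order[OF c(1)] D by simp
  then have ord: "\<chi>.H.ord c = p"
    using p c \<chi>.H.ord_eq_1[OF c(1)] by (auto simp: prime_nat_iff)
  have "generate D {c} = carrier D"
  proof (rule card_subset_eq)
    show "finite (carrier D)"
      using D prime_gt_0_nat[OF p] by (auto simp: order_def intro: card_ge_0_finite)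
    show "generate D {c} \<subseteq> carrier D"
      using c(1) by (intro \<chi>.H.generate_incl) simp
    show "card (generate D {c}) = card (carrier D)"
      using ord D \<chi>.H.generate_pow_card[OF c(1)] by (simp add: order_def)
  qed
  then have ex: "\<exists>n::int. d = c [^]\<^bsub>D\<^esub> n" if "d \<in> carrier D" for d
    using that unfolding \<chi>.H.generate_pow[OF c(1)] by blast
  define dlog where "dlog d = (SOME n::int. d = c [^]\<^bsub>D\<^esub> n)" for d
  have dlog: "c [^]\<^bsub>D\<^esub> dlog d = d" if "d \<in> carrier D" for d
    unfolding dlog_def using someI_ex[OF ex[OF that]] by simp
  have pow_cong: "k [^]\<^bsub>K\<^esub> m = k [^]\<^bsub>K\<^esub> n"
    if k: "k \<in> carrier K" and eq: "c [^]\<^bsub>D\<^esub> m = c [^]\<^bsub>D\<^esub> n" for k and m n :: int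
  proof -
    have "c [^]\<^bsub>D\<^esub> (m - n) = \<one>\<^bsub>D\<^esub>"
      using c(1) eq by (simp add: \<chi>.H.int_pow_diff)
    then have "int p dvd m - n"
      using \<chi>.H.int_pow_eq_id[OF c(1)] ord by simp
    moreover have "int (K.ord k) dvd int p"
      using exp[OF k] K.pow_eq_id[OF k] by simp
    ultimately have "k [^]\<^bsub>K\<^esub> (m - n) = \<one>\<^bsub>K\<^esub>"
      using K.int_pow_eq_id[OF k] dvd_trans by blast
    then show ?thesis
      using k by (simp add: K.int_pow_diff K.inv_solve_right')
  qed
  define \<beta> where "\<beta> h k = k [^]\<^bsub>K\<^esub> dlog (\<chi> h)" for h k
  show thesis
  proof (rule that[of \<beta>])
    fix h h' k assume h: "h \<in> carrier H" "h' \<in> carrier H" and k: "k \<in> carrier K"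
    have "k [^]\<^bsub>K\<^esub> dlog (\<chi> (h \<otimes>\<^bsub>H\<^esub> h')) = k [^]\<^bsub>K\<^esub> (dlog (\<chi> h) + dlog (\<chi> h'))"
      using h c(1) by (intro pow_cong[OF k]) (simp add: \<chi>.H.int_pow_mult dlog del: \<chi>.hom_mult, simp)
    then show "\<beta> (h \<otimes>\<^bsub>H\<^esub> h') k = \<beta> h k \<otimes>\<^bsub>K\<^esub> \<beta> h' k"
      using k by (simp add: \<beta>_def K.int_pow_mult)
  next
    fix k assume k: "k \<in> carrier K" and "\<forall>h \<in> carrier H. \<beta> h k = \<one>\<^bsub>K\<^esub>"
    then have "k [^]\<^bsub>K\<^esub> dlog c = \<one>\<^bsub>K\<^esub>"
      using y by (simp add: \<beta>_def c_def)
    moreover have "k [^]\<^bsub>K\<^esub> dlog c = k [^]\<^bsub>K\<^esub> (1::int)"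
      using c(1) by (intro pow_cong[OF k]) (simp add: dlog)
    ultimately show "k = \<one>\<^bsub>K\<^esub>" using k by simp
  qed (simp_all add: \<beta>_def K.int_pow_distrib)
qed

text \<open>
  Let \<open>\<pi> : F \<rightarrow> H\<close> be an epimorphism with kernel \<open>Z(F)\<close>. The pairing, pulled back to \<open>F \<times> K\<close>, is a
  2-cocycle with values in \<open>A\<close>, and \<open>E\<close> is the corresponding central extension of \<open>F \<times> K\<close> by \<open>A\<close>. The
  commutator of \<open>g \<in> F\<close> with \<open>k \<in> K\<close> in \<open>E\<close> is \<open>\<beta>(\<pi> g, k)\<close>. By nondegeneracy no \<open>k \<noteq> 1\<close> stays
  central, while \<open>Z(F)\<close> does, as \<open>\<beta>\<close> is trivial on \<open>\<pi>(Z(F)) = 1\<close>. So \<open>Z(E) = Z(F) \<times> 1 \<times> A\<close>.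
\<close>

lemma capable_DirProd:
  fixes H :: "('a, 'b) monoid_scheme" and K :: "('c, 'd) monoid_scheme"
    and A :: "('e, 'f) monoid_scheme"
  assumes H: "group H" "capable H" and "comm_group K" and "comm_group A"
    and \<beta>: "\<And>h k. h \<in> carrier H \<Longrightarrow> k \<in> carrier K \<Longrightarrow> \<beta> h k \<in> carrier A"
    and \<beta>_left: "\<And>h h' k. h \<in> carrier H \<Longrightarrow> h' \<in> carrier H \<Longrightarrow> k \<in> carrier K \<Longrightarrow>
      \<beta> (h \<otimes>\<^bsub>H\<^esub> h') k = \<beta> h k \<otimes>\<^bsub>A\<^esub> \<beta> h' k"
    and \<beta>_right: "\<And>h k k'. h \<in> carrier H \<Longrightarrow> k \<in> carrier K \<Longrightarrow> k' \<in> carrier K \<Longrightarrow>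
      \<beta> h (k \<otimes>\<^bsub>K\<^esub> k') = \<beta> h k \<otimes>\<^bsub>A\<^esub> \<beta> h k'"
    and nondegenerate: "\<And>k. k \<in> carrier K \<Longrightarrow> \<forall>h \<in> carrier H. \<beta> h k = \<one>\<^bsub>A\<^esub> \<Longrightarrow> k = \<one>\<^bsub>K\<^esub>"
  shows "capable (H \<times>\<times> K)"
proof -
  interpret H: group H by fact
  interpret K: comm_group K by fact
  interpret A: comm_group A by fact
  obtain F :: "('a \<times> bool) list monoid" and \<pi> where "central_epimorphism F H \<pi>"
    using H.capable_imp_central_epimorphism[OF H(2)] by blast
  then interpret F: central_epimorphism F H \<pi> .
  have \<beta>_one_left: "\<beta> \<one>\<^bsub>H\<^esub> k = \<one>\<^bsub>A\<^esub>" if "k \<in> carrier K" for k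
    using \<beta>_left[of "\<one>\<^bsub>H\<^esub>" "\<one>\<^bsub>H\<^esub>" k] \<beta>[of "\<one>\<^bsub>H\<^esub>" k] that by simp
  have \<beta>_one_right: "\<beta> h \<one>\<^bsub>K\<^esub> = \<one>\<^bsub>A\<^esub>" if "h \<in> carrier H" for h
    using \<beta>_right[of h "\<one>\<^bsub>K\<^esub>" "\<one>\<^bsub>K\<^esub>"] \<beta>[of h "\<one>\<^bsub>K\<^esub>"] that by simp
  define E where "E = \<lparr>carrier = carrier F \<times> carrier K \<times> carrier A,
    monoid.mult = (\<lambda>(f, k, a) (f', k', a').
      (f \<otimes>\<^bsub>F\<^esub> f', k \<otimes>\<^bsub>K\<^esub> k', a \<otimes>\<^bsub>A\<^esub> a' \<otimes>\<^bsub>A\<^esub> \<beta> (\<pi> f) k')),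
    one = (\<one>\<^bsub>F\<^esub>, \<one>\<^bsub>K\<^esub>, \<one>\<^bsub>A\<^esub>)\<rparr>"
  have carrier_E: "carrier E = carrier F \<times> carrier K \<times> carrier A"
    and one_E: "\<one>\<^bsub>E\<^esub> = (\<one>\<^bsub>F\<^esub>, \<one>\<^bsub>K\<^esub>, \<one>\<^bsub>A\<^esub>)"
    and mult_E: "(f, k, a) \<otimes>\<^bsub>E\<^esub> (f', k', a') =
      (f \<otimes>\<^bsub>F\<^esub> f', k \<otimes>\<^bsub>K\<^esub> k', a \<otimes>\<^bsub>A\<^esub> a' \<otimes>\<^bsub>A\<^esub> \<beta> (\<pi> f) k')" for f k a f' k' a'
    by (simp_all add: E_def)
  interpret E: group E
  proof (rule groupI)
    fix x assume "x \<in> carrier E"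
    then obtain f k a where x: "x = (f, k, a)"
      and fka: "f \<in> carrier F" "k \<in> carrier K" "a \<in> carrier A"
      by (auto simp: carrier_E)
    let ?y = "(inv\<^bsub>F\<^esub> f, inv\<^bsub>K\<^esub> k, inv\<^bsub>A\<^esub> (a \<otimes>\<^bsub>A\<^esub> \<beta> (\<pi> (inv\<^bsub>F\<^esub> f)) k))"
    have "?y \<otimes>\<^bsub>E\<^esub> x = \<one>\<^bsub>E\<^esub>"
      using fka \<beta>[of "\<pi> (inv\<^bsub>F\<^esub> f)" k] A.m_assoc[of _ a]
      by (simp add: x mult_E one_E del: F.hom_inv)
    moreover have "?y \<in> carrier E"
      using fka \<beta> by (simp add: carrier_E)
    ultimately show "\<exists>y \<in> carrier E. y \<otimes>\<^bsub>E\<^esub> x = \<one>\<^bsub>E\<^esub>" by blast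
  qed (auto simp: carrier_E one_E mult_E \<beta> \<beta>_left \<beta>_right \<beta>_one_left
      F.G.m_assoc K.m_assoc A.m_ac)
  define \<Phi> where "\<Phi> = (\<lambda>(f, k :: 'c, a :: 'e). (\<pi> f, k))"
  have ker: "kernel E (H \<times>\<times> K) \<Phi> = center E"
  proof
    show "kernel E (H \<times>\<times> K) \<Phi> \<subseteq> center E"
    proof
      fix x assume "x \<in> kernel E (H \<times>\<times> K) \<Phi>"
      then obtain f a where x: "x = (f, \<one>\<^bsub>K\<^esub>, a)" "f \<in> carrier F" "a \<in> carrier A"
        and f: "\<pi> f = \<one>\<^bsub>H\<^esub>"
        by (auto simp: kernel_def carrier_E \<Phi>_def)
      then have fc: "f \<in> center F" by (simp add: F.pi_eq_one_iff)
      have "x \<otimes>\<^bsub>E\<^esub> y = y \<otimes>\<^bsub>E\<^esub> x" if "y \<in> carrier E" for y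
        using that x f F.G.center_memD(2)[OF fc]
        by (auto simp: carrier_E mult_E \<beta>_one_left \<beta>_one_right A.m_comm)
      then show "x \<in> center E"
        using x by (intro E.center_memI) (simp_all add: carrier_E)
    qed
    show "center E \<subseteq> kernel E (H \<times>\<times> K) \<Phi>"
    proof
      fix x assume xz: "x \<in> center E"
      then obtain f k a where x: "x = (f, k, a)"
        and fka: "f \<in> carrier F" "k \<in> carrier K" "a \<in> carrier A"
        using E.center_memD(1)[OF xz] by (auto simp: carrier_E)
      (* compare the F- and A-components of the products of x with (g, 1, 1) in both orders *)
      have comm: "f \<otimes>\<^bsub>F\<^esub> g = g \<otimes>\<^bsub>F\<^esub> f" "\<beta> (\<pi> g) k = \<one>\<^bsub>A\<^esub>" if g: "g \<in> carrier F" for g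
      proof -
        have "x \<otimes>\<^bsub>E\<^esub> (g, \<one>\<^bsub>K\<^esub>, \<one>\<^bsub>A\<^esub>) = (g, \<one>\<^bsub>K\<^esub>, \<one>\<^bsub>A\<^esub>) \<otimes>\<^bsub>E\<^esub> x"
          by (rule E.center_memD(2)[OF xz]) (simp add: carrier_E g)
        then show "f \<otimes>\<^bsub>F\<^esub> g = g \<otimes>\<^bsub>F\<^esub> f" "\<beta> (\<pi> g) k = \<one>\<^bsub>A\<^esub>"
          using fka g \<beta>[of "\<pi> g" k] by (simp_all add: x mult_E \<beta>_one_right)
      qed
      have "k = \<one>\<^bsub>K\<^esub>"
        using comm(2) F.lift by (intro nondegenerate[OF fka(2)]) blast
      moreover have "f \<in> center F"
        using comm(1) fka(1) unfolding center_def by blast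
      ultimately show "x \<in> kernel E (H \<times>\<times> K) \<Phi>"
        using fka F.pi_eq_one_iff by (simp add: kernel_def x carrier_E \<Phi>_def)
    qed
  qed
  have "\<Phi> \<in> hom E (H \<times>\<times> K)"
    by (rule homI) (auto simp: carrier_E mult_E \<Phi>_def)
  moreover have "\<Phi> ` carrier E = carrier (H \<times>\<times> K)"
  proof -
    have "(h, k) \<in> \<Phi> ` carrier E" if h: "h \<in> carrier H" and k: "k \<in> carrier K" for h k
    proof -
      obtain f where "f \<in> carrier F" "\<pi> f = h" using h by (rule F.lift)
      then show ?thesis
        using h k by (intro image_eqI[of _ _ "(f, k, \<one>\<^bsub>A\<^esub>)"]) (simp_all add: \<Phi>_def carrier_E)
    qed
    then show ?thesis by (auto simp: \<Phi>_def carrier_E)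
  qed
  ultimately have "central_epimorphism E (H \<times>\<times> K) \<Phi>"
    using ker by (intro central_epimorphism.intro group_hom.intro group_hom_axioms.intro
        central_epimorphism_axioms.intro E.group_axioms DirProd_group H.group_axioms K.group_axioms)
  then show ?thesis
    by (rule central_epimorphism.capable_image)
qed

text \<open>
  As \<open>H\<close> is not abelian, it has elements \<open>x\<close> and \<open>y\<close> that do not commute, and \<open>g \<mapsto> [x, g]\<close> is a
  nontrivial homomorphism from \<open>H\<close> to \<open>Z(H) = H'\<close>, a group of order \<open>p\<close>.
\<close>

corollary capable_DirProd_extra_special:
  fixes H :: "('a, 'b) monoid_scheme" and K :: "('c, 'd) monoid_scheme"
  assumes H: "extra_special p H" "capable H" and K: "comm_group K"
    and exp: "\<And>k. k \<in> carrier K \<Longrightarrow> k [^]\<^bsub>K\<^esub> p = \<one>\<^bsub>K\<^esub>"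
  shows "capable (H \<times>\<times> K)"
proof -
  have p: "Factorial_Ring.prime p" and "group H"
    and center: "center H = derived H (carrier H)" and card: "card (center H) = p"
    using H(1) by (auto simp: extra_special_def)
  interpret group H by fact
  have "\<not> comm_group H"
    using comm_group.derived_eq_singleton[of H "carrier H"] card center p by auto
  then obtain x y where x: "x \<in> carrier H" and y: "y \<in> carrier H"
    and xy: "x \<otimes>\<^bsub>H\<^esub> y \<noteq> y \<otimes>\<^bsub>H\<^esub> x"
    using group_comm_groupI by blast
  have "x \<otimes>\<^bsub>H\<^esub> g \<otimes>\<^bsub>H\<^esub> inv\<^bsub>H\<^esub> x \<otimes>\<^bsub>H\<^esub> inv\<^bsub>H\<^esub> g \<in> center H" if "g \<in> carrier H" for g
    unfolding center derived_def using x that by (intro generate.incl) blast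
  then have \<chi>: "group_hom H (H\<lparr>carrier := center H\<rparr>)
      (\<lambda>g. x \<otimes>\<^bsub>H\<^esub> g \<otimes>\<^bsub>H\<^esub> inv\<^bsub>H\<^esub> x \<otimes>\<^bsub>H\<^esub> inv\<^bsub>H\<^esub> g)"
    using x by (intro commutator_hom)
  have order: "order (H\<lparr>carrier := center H\<rparr>) = p"
    using card by (simp add: order_def)
  have "x \<otimes>\<^bsub>H\<^esub> y \<otimes>\<^bsub>H\<^esub> inv\<^bsub>H\<^esub> x \<otimes>\<^bsub>H\<^esub> inv\<^bsub>H\<^esub> y \<noteq> \<one>\<^bsub>H\<lparr>carrier := center H\<rparr>\<^esub>"
    using x y xy by (simp add: commutator_eq_one_iff)
  from prime_order_pairing[OF p \<chi> order y this K exp] obtain \<beta> where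
    "\<And>h k. h \<in> carrier H \<Longrightarrow> k \<in> carrier K \<Longrightarrow> \<beta> h k \<in> carrier K"
    "\<And>h h' k. h \<in> carrier H \<Longrightarrow> h' \<in> carrier H \<Longrightarrow> k \<in> carrier K \<Longrightarrow>
      \<beta> (h \<otimes>\<^bsub>H\<^esub> h') k = \<beta> h k \<otimes>\<^bsub>K\<^esub> \<beta> h' k"
    "\<And>h k k'. h \<in> carrier H \<Longrightarrow> k \<in> carrier K \<Longrightarrow> k' \<in> carrier K \<Longrightarrow>
      \<beta> h (k \<otimes>\<^bsub>K\<^esub> k') = \<beta> h k \<otimes>\<^bsub>K\<^esub> \<beta> h k'"
    "\<And>k. k \<in> carrier K \<Longrightarrow> \<forall>h \<in> carrier H. \<beta> h k = \<one>\<^bsub>K\<^esub> \<Longrightarrow> k = \<one>\<^bsub>K\<^esub>"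
    by blast
  then show ?thesis
    by (rule capable_DirProd[OF \<open>group H\<close> H(2) K K])
qed

section \<open>Central products with an extra special group\<close>

text \<open>
  The hypotheses enter through three facts: \<open>G' = H' = Z(H)\<close>, as \<open>H' \<subseteq> G'\<close> and both have order \<open>p\<close>;
  \<open>G' \<subseteq> Z(G)\<close>, as \<open>Z(H)\<close> commutes with both factors of \<open>G = H Z(G)\<close>; and \<open>g\<^sup>p \<in> G'\<close> for all \<open>g\<close>.
  For a complement \<open>K\<close> of \<open>G'\<close> in \<open>Z(G)\<close> this yields \<open>H \<inter> K \<subseteq> Z(H) \<inter> K = 1\<close>, \<open>H K = H G' K = G\<close> and
  \<open>K\<^sup>p \<subseteq> G' \<inter> K = 1\<close>.
\<close>

theorem (in group) capable_central_product_iff: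
  assumes p: "Factorial_Ring.prime p"
    and fin: "finite (carrier G)"
    and card_D: "card (derived G (carrier G)) = p"
    and elem: "elementary_abelian p (G Mod (derived G (carrier G)))"
    and H: "subgroup H G"
    and extra: "extra_special p (G\<lparr>carrier := H\<rparr>)"
    and prod: "internal_central_product G H (center G)"
  shows "capable G \<longleftrightarrow>
    capable (G\<lparr>carrier := H\<rparr>) \<and>
    direct_summand (derived G (carrier G)) (G\<lparr>carrier := center G\<rparr>)"
proof -
  let ?D = "derived G (carrier G)" and ?Z = "G\<lparr>carrier := center G\<rparr>"
  interpret S: subgroup H G by (rule H)
  interpret H: group "G\<lparr>carrier := H\<rparr>" using H by (rule subgroup_imp_group)
  interpret Z: comm_group ?Z by (rule comm_group_center)
  interpret zG: normal "center G" G by (rule center_normal)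
  interpret D: normal ?D G by (rule derived_self_is_normal)
  have HZ: "H <#> center G = carrier G"
    using prod by (simp add: internal_central_product_def)
  have decomp: "\<exists>h\<in>H. \<exists>z\<in>center G. g = h \<otimes> z" if "g \<in> carrier G" for g
    using that unfolding HZ[symmetric] set_mult_def by blast
  have D_H: "derived (G\<lparr>carrier := H\<rparr>) H = ?D"
  proof (rule card_subset_eq)
    show "finite ?D" using D.subset fin by (rule finite_subset)
    show "derived (G\<lparr>carrier := H\<rparr>) H \<subseteq> ?D"
      using derived_consistent[OF subset_refl H] mono_derived[OF S.subset] by simp
    show "card (derived (G\<lparr>carrier := H\<rparr>) H) = card ?D"
      using card_D extra by (simp add: extra_special_def)
  qed
  then have center_H: "center (G\<lparr>carrier := H\<rparr>) = ?D"
    using extra by (simp add: extra_special_def)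
  have D_sub_H: "?D \<subseteq> H"
    using center_H unfolding center_def by auto
  have D_sub_Z: "?D \<subseteq> center G"
  proof
    fix d assume d: "d \<in> ?D"
    then have dH: "d \<in> center (G\<lparr>carrier := H\<rparr>)" by (simp add: center_H)
    have dc: "d \<in> carrier G" using d by (rule D.mem_carrier)
    have "d \<otimes> g = g \<otimes> d" if g: "g \<in> carrier G" for g
    proof -
      obtain h z where h: "h \<in> H" and z: "z \<in> center G" and gz: "g = h \<otimes> z"
        using decomp[OF g] by blast
      have "d \<otimes> h = h \<otimes> d" using H.center_memD(2)[OF dH] h by simp
      moreover have "z \<otimes> d = d \<otimes> z" by (rule center_memD(2)[OF z dc])
      ultimately show ?thesis
        using dc h z unfolding gz by (metis S.mem_carrier m_assoc zG.mem_carrier)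
    qed
    then show "d \<in> center G" using dc unfolding center_def by blast
  qed
  have D_Z: "subgroup ?D ?Z"
    by (rule subgroup_incl[OF D.subgroup_axioms zG.subgroup_axioms D_sub_Z])
  have p_pow: "g [^] p \<in> ?D" if g: "g \<in> carrier G" for g
  proof -
    have hom: "group_hom G (G Mod ?D) (\<lambda>g. ?D #> g)"
      using D.r_coset_hom_Mod D.factorgroup_is_group
      by (simp add: group_hom_def group_hom_axioms_def)
    have "?D #> (g [^] p) = (?D #> g) [^]\<^bsub>G Mod ?D\<^esub> p"
      using group_hom.hom_nat_pow[OF hom g] by simp
    also have "\<dots> = \<one>\<^bsub>G Mod ?D\<^esub>"
      using elem group_hom.hom_closed[OF hom g] by (simp add: elementary_abelian_def)
    finally have "?D #> (g [^] p) = ?D" by (simp add: FactGroup_def)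
    then show ?thesis
      using rcos_self[OF _ D.subgroup_axioms, of "g [^] p"] g by simp
  qed
  show ?thesis
  proof
    assume "capable G"
    then obtain E :: "('a \<times> bool) list monoid" and \<pi> where "central_epimorphism E G \<pi>"
      using capable_imp_central_epimorphism by blast
    then interpret E: central_epimorphism E G \<pi> .
    have H_capable: "capable (G\<lparr>carrier := H\<rparr>)"
      using H HZ by (rule E.capable_central_factor) (simp add: center_H)
    have exp: "x [^]\<^bsub>?Z\<^esub> p = \<one>\<^bsub>?Z\<^esub>" if "x \<in> carrier ?Z" for x
      using E.center_exponent[OF p_pow] that by (simp flip: nat_pow_consistent)
    have "finite (carrier ?Z)"
      using finite_subset[OF zG.subset fin] by simp
    then obtain K where "subgroup K ?Z" "?D \<inter> K = {\<one>\<^bsub>?Z\<^esub>}" "?D <#>\<^bsub>?Z\<^esub> K = carrier ?Z"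
      using Z.subgroup_complement[OF _ p exp D_Z] by blast
    then have "direct_summand ?D ?Z"
      using Z.comm_group_axioms D_Z unfolding direct_summand_def by blast
    with H_capable show "capable (G\<lparr>carrier := H\<rparr>) \<and> direct_summand ?D ?Z" by blast
  next
    assume R: "capable (G\<lparr>carrier := H\<rparr>) \<and> direct_summand ?D ?Z"
    then obtain K where K_Z: "subgroup K ?Z" and DK: "?D \<inter> K = {\<one>}"
      and DKZ: "?D <#> K = center G"
      by (auto simp: direct_summand_def set_mult_def)
    have K: "subgroup K G"
      using K_Z zG.subgroup_axioms by (rule incl_subgroup[rotated])
    have K_sub: "K \<subseteq> center G"
      using subgroup.subset[OF K_Z] by simp
    interpret K: subgroup K G by (rule K)
    interpret group_disjoint_sum G H K ..
    have comm_K: "comm_group (G\<lparr>carrier := K\<rparr>)"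
      by (rule group.group_comm_groupI[OF subgroup_imp_group[OF K]])
        (use K_sub center_memD(2) in auto)
    have exp_K: "k [^]\<^bsub>G\<lparr>carrier := K\<rparr>\<^esub> p = \<one>\<^bsub>G\<lparr>carrier := K\<rparr>\<^esub>" if "k \<in> K" for k
    proof -
      have "k [^] p \<in> ?D \<inter> K"
        using that p_pow subgroup_int_pow_closed[OF K that, of "int p"] by (simp add: int_pow_int)
      then show ?thesis using DK by (simp flip: nat_pow_consistent)
    qed
    have "H \<inter> K \<subseteq> center (G\<lparr>carrier := H\<rparr>)"
      using K_sub unfolding center_def by auto
    then have HK1: "H \<inter> K = {\<one>}"
      using DK center_H by auto
    have "g \<in> H <#> K" if g: "g \<in> carrier G" for g
    proof -
      obtain h z where h: "h \<in> H" and z: "z \<in> center G" and gz: "g = h \<otimes> z"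
        using decomp[OF g] by blast
      obtain d k where d: "d \<in> ?D" and k: "k \<in> K" and dk: "z = d \<otimes> k"
        using z unfolding DKZ[symmetric] set_mult_def by blast
      have "g = (h \<otimes> d) \<otimes> k"
        using h d k D_sub_H unfolding gz dk by (simp add: m_assoc)
      moreover have "h \<otimes> d \<in> H" using h d D_sub_H by blast
      ultimately show ?thesis using k unfolding set_mult_def by blast
    qed
    then have HK: "H <#> K = carrier G"
      using setmult_subset_G[OF S.subset K.subset] by blast
    have "(\<lambda>(x, y). x \<otimes> y) \<in> Group.iso (subgroup_generated G H \<times>\<times> subgroup_generated G K) G"
      unfolding iso_group_mul_alt using HK1 HK K_sub center_memD(2) S.subset
      by (metis S.mem_carrier subsetD)
    moreover have "subgroup_generated G H = G\<lparr>carrier := H\<rparr>" "subgroup_generated G K = G\<lparr>carrier := K\<rparr>"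
      using S.carrier_subgroup_generated_subgroup K.carrier_subgroup_generated_subgroup
      unfolding carrier_subgroup_generated by (simp_all only: subgroup_generated_def)
    ultimately have "G \<cong> (G\<lparr>carrier := H\<rparr> \<times>\<times> G\<lparr>carrier := K\<rparr>)"
      using group.iso_sym[OF DirProd_group[OF H.group_axioms subgroup_imp_group[OF K]]]
      unfolding is_iso_def by auto
    moreover have "capable (G\<lparr>carrier := H\<rparr> \<times>\<times> G\<lparr>carrier := K\<rparr>)"
      using extra R comm_K exp_K by (intro capable_DirProd_extra_special) auto
    ultimately show "capable G" by (rule capable_iso)
  qed
qed

theorem theorem3p2:
  fixes G :: "('a, 'b) monoid_scheme" and H :: "'a set" and p n :: nat
  assumes "Factorial_Ring.prime p"
    and "group G"
    and "finite (carrier G)"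
    and "order G = p ^ n"
    and "card (derived G (carrier G)) = p"
    and "elementary_abelian p (G Mod (derived G (carrier G)))"
    and "subgroup H G"
    and "extra_special p (G\<lparr>carrier := H\<rparr>)"
    and "internal_central_product G H (center G)"
  shows "capable G \<longleftrightarrow>
    capable (G\<lparr>carrier := H\<rparr>) \<and>
    direct_summand (derived G (carrier G)) (G\<lparr>carrier := center G\<rparr>)"
  using assms by (intro group.capable_central_product_iff)

end
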